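(* Let $X$ be a complex Hilbert space, and let $Y$ be a complex Banach space. Let $T \in \mathcal{L}(X)$ be power-bounded, and let $S \in \mathcal{L}(Y,X)$. If $D \in \mathcal{L}(X)$ commutes with $T$ and satisfies $\sup_{\lambda \in \mathbb{C},\, |\lambda|>1}\|R(\lambda,T)D\| < 1$, then the following statements hold: a) $T+D$ is power-bounded. b) Let $f \colon (0,\infty) \to (0,\infty)$ be $\alpha$-bounded regularly varying for some $\alpha > 0$. If $\|T^nS\| = O(1/f(n))$ as $n \to \infty$, then $\|(T+D)^nS\| = O(1/f(n))$ as $n \to \infty$.
   Context: $\mathcal{L}(Y,X)$ denotes the space of bounded linear operators from $Y$ to $X$, and $\mathcal{L}(X)=\mathcal{L}(X,X)$. An operator $T \in \mathcal{L}(X)$ is power-bounded if $\sup_{n \ge 0}\|T^n\| < \infty$ (then its spectral radius is at most $1$). For $\lambda$ in the resolvent set of $T$, $R(\lambda,T) = (\lambda I - T)^{-1}$. For $\alpha \ge 0$, a function $f \colon (0,\infty) \to (0,\infty)$ is called $\alpha$-bounded regularly varying if there exists $t_0>0$ such that $f$ is non-decreasing on $[t_0,\infty)$, is absolutely continuous on each compact subinterval of $[t_0,\infty)$, and satisfies $t f'(t)/f(t) \le \alpha$ for a.e. $t \ge t_0$. $a(n) = O(b(n))$ as $n\to\infty$ means there are constants $K>0$, $n_0$ with $a(n)\le K b(n)$ for all $n \ge n_0$. *)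

theory Defs
  imports "HOL-Analysis.Analysis" "HOL-Library.Landau_Symbols"
begin

class complex_vector = real_vector +
  fixes scaleC :: "complex \<Rightarrow> 'a \<Rightarrow> 'a"  (infixr \<open>*\<^sub>C\<close> 75)
  assumes scaleC_add_right: "a *\<^sub>C (x + y) = a *\<^sub>C x + a *\<^sub>C y"
    and scaleC_add_left: "(a + b) *\<^sub>C x = a *\<^sub>C x + b *\<^sub>C x"
    and scaleC_scaleC: "a *\<^sub>C (b *\<^sub>C x) = (a * b) *\<^sub>C x"
    and scaleC_one: "1 *\<^sub>C x = x"
    and scaleR_scaleC: "r *\<^sub>R x = complex_of_real r *\<^sub>C x"

class complex_normed_vector = complex_vector + real_normed_vector +
  assumes norm_scaleC: "norm (a *\<^sub>C x) = cmod a * norm x"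

class cbanach = complex_normed_vector + complete_space

class complex_inner = complex_normed_vector +
  fixes cinner :: "'a \<Rightarrow> 'a \<Rightarrow> complex"
  assumes cinner_commute: "cinner x y = cnj (cinner y x)"
    and cinner_add_left: "cinner (x + y) z = cinner x z + cinner y z"
    and cinner_scaleC_left: "cinner (a *\<^sub>C x) y = a * cinner x y"
    and cinner_ge_zero: "0 \<le> Re (cinner x x)"
    and cinner_eq_zero_iff: "cinner x x = 0 \<longleftrightarrow> x = 0"
    and norm_eq_sqrt_cinner: "norm x = sqrt (Re (cinner x x))"

class chilbert_space = complex_inner + complete_space

instantiation complex :: chilbert_space
begin

definition scaleC_complex :: "complex \<Rightarrow> complex \<Rightarrow> complex"
  where "scaleC_complex a z = a * z"

definition cinner_complex :: "complex \<Rightarrow> complex \<Rightarrow> complex"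
  where "cinner_complex z w = z * cnj w"

instance
proof
  fix a b x y z :: complex and r :: real
  show "a *\<^sub>C (x + y) = a *\<^sub>C x + a *\<^sub>C y"
    and "(a + b) *\<^sub>C x = a *\<^sub>C x + b *\<^sub>C x"
    and "a *\<^sub>C (b *\<^sub>C x) = (a * b) *\<^sub>C x"
    and "1 *\<^sub>C x = x"
    by (simp_all add: scaleC_complex_def algebra_simps)
  show "r *\<^sub>R x = complex_of_real r *\<^sub>C x"
    by (simp add: scaleC_complex_def scaleR_conv_of_real)
  show "norm (a *\<^sub>C x) = cmod a * norm x"
    by (simp add: scaleC_complex_def norm_mult)
  show "cinner x y = cnj (cinner y x)"
    and "cinner (x + y) z = cinner x z + cinner y z"
    and "cinner (a *\<^sub>C x) y = a * cinner x y"
    and "0 \<le> Re (cinner x x)"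
    and "cinner x x = 0 \<longleftrightarrow> x = 0"
    by (simp_all add: cinner_complex_def scaleC_complex_def algebra_simps)
  show "norm x = sqrt (Re (cinner x x))"
    by (simp add: cinner_complex_def cmod_def power2_eq_square)
qed

end

definition bounded_clinear ::
    "('a::complex_normed_vector \<Rightarrow> 'b::complex_normed_vector) \<Rightarrow> bool"
  where "bounded_clinear T \<longleftrightarrow>
    bounded_linear T \<and> (\<forall>a x. T (a *\<^sub>C x) = a *\<^sub>C T x)"

text \<open>
  The supremum is taken in the extended reals, so that it is \<open>\<infinity>\<close> for an unbounded sequence.
\<close>
definition power_bounded :: "('a::complex_normed_vector \<Rightarrow> 'a) \<Rightarrow> bool"
  where "power_bounded T \<longleftrightarrow>
    bounded_clinear T \<and> (SUP n::nat. ereal (onorm (T ^^ n))) < \<infinity>"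

text \<open>
  Meaningful only for \<open>\<mu>\<close> in the resolvent set of \<open>T\<close>. This contains all \<open>\<mu>\<close> with
  \<open>cmod \<mu> > 1\<close> if \<open>T\<close> is a power-bounded operator on a Banach space.
\<close>
definition resolvent ::
    "complex \<Rightarrow> ('a::complex_normed_vector \<Rightarrow> 'a) \<Rightarrow> 'a \<Rightarrow> 'a"
  where "resolvent \<mu> T = inv (\<lambda>x. \<mu> *\<^sub>C x - T x)"

text \<open>
  A division is a finite family of nonempty compact intervals with disjoint interiors;
  \<open>Inf k\<close> and \<open>Sup k\<close> are the endpoints of the interval \<open>k\<close>.
\<close>
definition absolutely_continuous_on :: "real set \<Rightarrow> (real \<Rightarrow> real) \<Rightarrow> bool"
  where "absolutely_continuous_on A f \<longleftrightarrow>
    (\<forall>\<epsilon>>0. \<exists>\<delta>>0. \<forall>d. d division_of \<Union>d \<and> \<Union>d \<subseteq> A \<and> (\<Sum>k\<in>d. Sup k - Inf k) < \<delta>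
      \<longrightarrow> (\<Sum>k\<in>d. \<bar>f (Sup k) - f (Inf k)\<bar>) < \<epsilon>)"

text \<open>
  Functions from \<open>(0, \<infinity>)\<close> to \<open>(0, \<infinity>)\<close> are total functions on the reals whose values outside
  \<open>(0, \<infinity>)\<close> are irrelevant. Differentiability almost everywhere is a consequence of absolute
  continuity; it is repeated because \<open>deriv f t\<close> is an unspecified number where \<open>f\<close> is not
  differentiable.
\<close>
definition bounded_regularly_varying :: "real \<Rightarrow> (real \<Rightarrow> real) \<Rightarrow> bool"
  where "bounded_regularly_varying \<alpha> f \<longleftrightarrow>
    (\<forall>t>0. f t > 0) \<and>
    (\<exists>t\<^sub>0>0. mono_on {t\<^sub>0..} f \<and>
      (\<forall>a b. t\<^sub>0 \<le> a \<and> a \<le> b \<longrightarrow> absolutely_continuous_on {a..b} f) \<and>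
      (AE t in lebesgue. t \<ge> t\<^sub>0 \<longrightarrow>
         f differentiable (at t) \<and> t * deriv f t / f t \<le> \<alpha>))"

end

theory Submission
  imports Defs
begin

text \<open>
  Put \<open>A = T + D\<close> and let \<open>z\<close> be the unilateral shift on sequences in the Hilbert space. By Plancherel,
  the operator \<open>W = z (1 - z T)\<inverse> D\<close>, with symbol \<open>R(\<lambda>, T) D\<close>, has norm at most
  \<open>q < 1\<close> on \<open>\<ell>\<^sup>2({0..n})\<close> for every \<open>n\<close>; Plancherel is used in the finite form given by
  the \<open>N\<close>-th roots of unity on a circle of radius \<open>r > 1\<close>, with \<open>N \<rightarrow> \<infinity>\<close> and then \<open>r \<rightarrow> 1\<close>.
  Since \<open>(1 - W) (1 - z A)\<inverse> = (1 - z T)\<inverse>\<close>, inverting \<open>1 - W\<close> costs a factor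
  \<open>1 / (1 - q)\<close>, so the truncated \<open>\<ell>\<^sup>2\<close> norms of \<open>(1 - z A)\<^bsup>-(p+1)\<^esup> x\<close>, whose coefficients are
  \<open>binom(j + p, p) A\<^sup>j x\<close>, are controlled by those of \<open>(1 - z T)\<^bsup>-(p+1)\<^esup> x\<close>. One more
  factor \<open>(1 - z A)\<inverse> = (1 - z T)\<inverse> (1 - W)\<inverse>\<close>, estimated by Cauchy-Schwarz and the
  power-boundedness of \<open>T\<close>, turns this into a bound for the single coefficient
  \<open>binom(n + p + 1, p + 1) A\<^sup>n x\<close>. Taking \<open>p = 0\<close> gives power-boundedness; for the decay rate one
  takes \<open>p \<ge> \<alpha>\<close>, for which \<open>t\<^sup>p / f(t)\<close> is non-decreasing.
\<close>

section \<open>Complex inner products and the discrete Fourier transform\<close>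

\<comment> \<open>This gives the convergence criteria for series in \<open>banach\<close> access to
  the Neumann series below.\<close>
subclass (in chilbert_space) banach ..

lemma scaleC_zero_right [simp]: "a *\<^sub>C 0 = (0::'a::complex_vector)"
  using scaleC_add_right[of a 0 "0::'a"] by simp

lemma scaleC_zero_left [simp]: "0 *\<^sub>C x = (0::'a::complex_vector)"
  using scaleC_add_left[of 0 0 x] by simp

lemma scaleC_minus_right: "a *\<^sub>C (- x) = - (a *\<^sub>C (x::'a::complex_vector))"
  using scaleC_add_right[of a x "- x"] by (simp add: eq_neg_iff_add_eq_0 add.commute)

lemma scaleC_diff_right: "a *\<^sub>C (x - y) = a *\<^sub>C x - a *\<^sub>C (y::'a::complex_vector)"
  using scaleC_add_right[of a x "- y"] by (simp add: scaleC_minus_right)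

lemma scaleC_sum_right: "a *\<^sub>C (\<Sum>i\<in>I. g i) = (\<Sum>i\<in>I. a *\<^sub>C (g i :: 'a::complex_vector))"
  by (induction I rule: infinite_finite_induct) (simp_all add: scaleC_add_right)

lemma scaleC_sum_left: "(\<Sum>i\<in>I. c i) *\<^sub>C x = (\<Sum>i\<in>I. c i *\<^sub>C (x :: 'a::complex_vector))"
  by (induction I rule: infinite_finite_induct) (simp_all add: scaleC_add_left)

lemma scaleR_scaleC_commute: "r *\<^sub>R (a *\<^sub>C x) = a *\<^sub>C (r *\<^sub>R (x :: 'a::complex_vector))"
  by (simp add: scaleR_scaleC scaleC_scaleC mult.commute)

lemma bounded_linear_scaleC: "bounded_linear (\<lambda>x. a *\<^sub>C (x :: 'a::complex_normed_vector))"
  by (rule bounded_linear_intro[where K = "cmod a"])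
     (simp_all add: scaleC_add_right scaleR_scaleC_commute norm_scaleC mult.commute)

lemma cinner_add_right: "cinner x (y + z) = cinner x y + cinner x (z :: 'a::complex_inner)"
  by (metis cinner_add_left cinner_commute complex_cnj_add)

lemma cinner_scaleC_right: "cinner x (a *\<^sub>C y) = cnj a * cinner x (y :: 'a::complex_inner)"
  by (metis cinner_commute cinner_scaleC_left complex_cnj_mult)

lemma cinner_zero_left [simp]: "cinner 0 (y :: 'a::complex_inner) = 0"
  using cinner_add_left[of 0 0 y] by simp

lemma cinner_zero_right [simp]: "cinner (y :: 'a::complex_inner) 0 = 0"
  using cinner_add_right[of y 0 0] by simp

lemma cinner_sum_left: "cinner (\<Sum>i\<in>I. g i) y = (\<Sum>i\<in>I. cinner (g i) (y :: 'a::complex_inner))"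
  by (induction I rule: infinite_finite_induct) (simp_all add: cinner_add_left)

lemma cinner_sum_right: "cinner y (\<Sum>i\<in>I. g i) = (\<Sum>i\<in>I. cinner y (g i :: 'a::complex_inner))"
  by (induction I rule: infinite_finite_induct) (simp_all add: cinner_add_right)

lemma norm_power2_eq_cinner: "(norm (x :: 'a::complex_inner))\<^sup>2 = Re (cinner x x)"
  by (simp add: norm_eq_sqrt_cinner cinner_ge_zero)

text \<open>Expanding the squared norms gives a double sum of inner products, and orthogonality
  removes the off-diagonal terms. This is where the inner product enters the argument. The weights
  \<open>E\<close> are left general because both the characters and their conjugates are
  needed.\<close>

lemma parseval_orthogonal:
  fixes g :: "nat \<Rightarrow> 'a::complex_inner"
  assumes orth: "\<And>i j. \<lbrakk>i < N; j < N\<rbrakk> \<Longrightarrow>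
      (\<Sum>m<N. E i m * cnj (E j m)) = (if i = j then complex_of_real c else 0)"
  shows "(\<Sum>m<N. (norm (\<Sum>j<N. E j m *\<^sub>C g j))\<^sup>2) = c * (\<Sum>j<N. (norm (g j))\<^sup>2)"
proof -
  have "(\<Sum>m<N. cinner (\<Sum>i<N. E i m *\<^sub>C g i) (\<Sum>j<N. E j m *\<^sub>C g j))
      = (\<Sum>m<N. \<Sum>i<N. \<Sum>j<N. E i m * cnj (E j m) * cinner (g i) (g j))"
    unfolding cinner_sum_left unfolding cinner_sum_right
    by (simp add: cinner_scaleC_left cinner_scaleC_right mult_ac)
  also have "\<dots> = (\<Sum>i<N. \<Sum>j<N. \<Sum>m<N. E i m * cnj (E j m) * cinner (g i) (g j))"
    by (subst sum.swap) (intro sum.cong refl sum.swap)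
  also have "\<dots> = (\<Sum>i<N. \<Sum>j<N. (\<Sum>m<N. E i m * cnj (E j m)) * cinner (g i) (g j))"
    by (simp add: sum_distrib_right)
  also have "\<dots> = (\<Sum>i<N. \<Sum>j<N. if i = j then complex_of_real c * cinner (g i) (g j) else 0)"
    by (intro sum.cong refl) (simp add: orth)
  also have "\<dots> = complex_of_real c * (\<Sum>i<N. cinner (g i) (g i))"
    by (simp add: sum_distrib_left)
  finally have "Re (\<Sum>m<N. cinner (\<Sum>i<N. E i m *\<^sub>C g i) (\<Sum>j<N. E j m *\<^sub>C g j))
      = c * Re (\<Sum>i<N. cinner (g i) (g i))"
    by simp
  then show ?thesis
    by (simp add: norm_power2_eq_cinner)
qed

section \<open>Orthogonality of the characters of the cyclic group of order N\<close>

definition dft_char :: "nat \<Rightarrow> nat \<Rightarrow> nat \<Rightarrow> complex"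
  where "dft_char N j k = cis (2 * pi * real j * real k / real N)"

lemma dft_char_commute: "dft_char N j k = dft_char N k j"
  by (simp add: dft_char_def mult_ac)

lemma dft_char_zero [simp]: "dft_char N j 0 = 1"
  by (simp add: dft_char_def)

lemma dft_char_period: "N > 0 \<Longrightarrow> dft_char N j N = 1"
  by (simp add: dft_char_def cis_multiple_2pi[of "real j", simplified])

lemma dft_char_Suc: "dft_char N j (Suc k) = dft_char N j 1 * dft_char N j k"
  by (simp add: dft_char_def cis_mult distrib_left add_divide_distrib)

lemma norm_dft_char [simp]: "cmod (dft_char N j k) = 1"
  by (simp add: dft_char_def)

lemma dft_char_power: "dft_char N j k = dft_char N j 1 ^ k"
  by (induction k) (simp, metis dft_char_Suc power_Suc)

text \<open>The summands are the powers of an N-th root of unity \<open>z\<close>. The geometric sum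
  vanishes unless \<open>z = 1\<close>, and distinctness of the roots of unity leaves only
  \<open>i = j\<close> for that.\<close>

lemma sum_dft_char:
  assumes "i < N" "j < N"
  shows "(\<Sum>m<N. dft_char N i m * cnj (dft_char N j m)) = (if i = j then of_real (real N) else 0)"
proof -
  define z where "z = dft_char N i 1 * cnj (dft_char N j 1)"
  have eq: "dft_char N i m * cnj (dft_char N j m) = z ^ m" for m
    by (simp add: z_def dft_char_power[of N _ m] power_mult_distrib)
  have zN: "z ^ N = 1"
    using eq[of N] assms by (simp add: dft_char_period)
  show ?thesis
  proof (cases "i = j")
    case True
    then have "z = 1"
      by (simp add: z_def complex_norm_square[symmetric])
    with True show ?thesis unfolding eq by simp
  next
    case False
    have "inj_on (\<lambda>k. cis (2 * pi * real k / real N)) {..<N}"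
      using Complex.bij_betw_roots_unity[of N] assms by (auto simp: bij_betw_def)
    then have "dft_char N i 1 \<noteq> dft_char N j 1"
      using assms False by (auto simp: dft_char_def inj_on_def)
    moreover have "z * dft_char N j 1 = dft_char N i 1"
      by (simp add: z_def mult.assoc mult.commute[of "cnj _"] complex_norm_square[symmetric])
    ultimately have "z \<noteq> 1" by auto
    with zN False show ?thesis by (simp add: eq sum_gp_strict)
  qed
qed

section \<open>Power-bounded operators and their resolvents\<close>

lemma funpow_bounded_linear:
  fixes T :: "'a::real_normed_vector \<Rightarrow> 'a"
  shows "bounded_linear T \<Longrightarrow> bounded_linear (T ^^ n)"
  by (induction n) (simp_all add: bounded_linear_compose o_def bounded_linear_ident id_def)

lemma power_bounded_iff:
  "power_bounded T \<longleftrightarrow>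
    bounded_clinear T \<and> (\<exists>K\<ge>0. \<forall>n x. norm ((T ^^ n) x) \<le> K * norm x)"
proof (cases "bounded_clinear T")
  case True
  then have bl: "bounded_linear (T ^^ n)" for n
    by (intro funpow_bounded_linear) (simp add: bounded_clinear_def)
  show ?thesis
  proof
    assume "power_bounded T"
    then have *: "(SUP n. ereal (onorm (T ^^ n))) < \<infinity>"
      by (simp add: power_bounded_def)
    then obtain K where K: "(SUP n. ereal (onorm (T ^^ n))) < ereal K"
      using less_PInf_Ex_of_nat by fastforce
    have "onorm (T ^^ n) \<le> K" for n
      using K SUP_upper[of n UNIV "\<lambda>n. ereal (onorm (T ^^ n))"]
      by (metis UNIV_I ereal_less_eq(3) less_imp_le order_trans)
    then have "norm ((T ^^ n) x) \<le> K * norm x" for n x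
      by (meson bl mult_right_mono norm_ge_zero onorm order_trans)
    moreover have "K \<ge> 0"
      using \<open>\<And>n. onorm (T ^^ n) \<le> K\<close> onorm_pos_le[OF bl] order_trans by blast
    ultimately show "bounded_clinear T \<and> (\<exists>K\<ge>0. \<forall>n x. norm ((T ^^ n) x) \<le> K * norm x)"
      using True by blast
  next
    assume "bounded_clinear T \<and> (\<exists>K\<ge>0. \<forall>n x. norm ((T ^^ n) x) \<le> K * norm x)"
    then obtain K where "K \<ge> 0" "\<And>n x. norm ((T ^^ n) x) \<le> K * norm x"
      by blast
    then have "ereal (onorm (T ^^ n)) \<le> ereal K" for n
      by (simp add: onorm_bound)
    then have "(SUP n. ereal (onorm (T ^^ n))) \<le> ereal K"
      by (rule SUP_least)
    then show "power_bounded T"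
      using True by (auto simp: power_bounded_def)
  qed
qed (simp add: power_bounded_def)

text \<open>The Neumann series \<open>h\<close> converges by power-boundedness and is a right
  inverse of \<mu> - T by telescoping. Identifying it with \<open>inv\<close> takes injectivity: an
  eigenvector for \<mu> would have orbit growing like |\<mu>|^n.\<close>

lemma resolvent_power_bounded:
  fixes T :: "'a::chilbert_space \<Rightarrow> 'a"
  assumes T: "bounded_clinear T" and K: "\<And>n x. norm ((T ^^ n) x) \<le> K * norm x"
    and \<mu>: "cmod \<mu> > 1"
  shows "bounded_linear (resolvent \<mu> T)"
    and "\<mu> *\<^sub>C resolvent \<mu> T x - T (resolvent \<mu> T x) = x"
proof -
  define G where "G x = \<mu> *\<^sub>C x - T x" for x
  define s where "s x k = (1 / \<mu>) ^ k *\<^sub>C (T ^^ k) x" for x k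
  define h where "h x = (1 / \<mu>) *\<^sub>C (\<Sum>k. s x k)" for x
  have blT: "bounded_linear T" and TC: "\<And>a x. T (a *\<^sub>C x) = a *\<^sub>C T x"
    using T by (simp_all add: bounded_clinear_def)
  have blG: "bounded_linear G"
    unfolding G_def by (intro bounded_linear_sub bounded_linear_scaleC blT)
  have \<mu>0: "\<mu> \<noteq> 0" using \<mu> by auto
  have ns: "norm (s x k) \<le> (1 / cmod \<mu>) ^ k * (K * norm x)" for x k
    using K[of k x] by (simp add: s_def norm_scaleC norm_power norm_divide mult_left_mono)
  have gs: "summable (\<lambda>k. (1 / cmod \<mu>) ^ k)"
    using \<mu> by (intro summable_geometric) (simp add: divide_less_eq)
  then have gs': "summable (\<lambda>k. (1 / cmod \<mu>) ^ k * (K * norm x))" for x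
    by (rule summable_mult2)
  have ss: "summable (s x)" for x
    by (rule summable_comparison_test'[OF gs' ns])
  have Gs: "G ((1 / \<mu>) *\<^sub>C s x k) = s x k - s x (Suc k)" for x k
    using \<mu>0 by (simp add: G_def s_def scaleC_scaleC TC scaleC_one)
  have Gh: "G (h x) = x" for x
  proof -
    have "(\<lambda>k. G ((1 / \<mu>) *\<^sub>C s x k)) sums (s x 0 - 0)"
      unfolding Gs by (intro telescope_sums' summable_LIMSEQ_zero ss)
    moreover have "(\<lambda>k. G ((1 / \<mu>) *\<^sub>C s x k)) sums G (h x)"
      unfolding h_def
      by (intro bounded_linear.sums[OF blG] bounded_linear.sums[OF bounded_linear_scaleC]
          summable_sums ss)
    ultimately show ?thesis
      using sums_unique2 by (fastforce simp: s_def scaleC_one)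
  qed
  have G0: "x = 0" if "G x = 0" for x
  proof (rule ccontr)
    assume "x \<noteq> 0"
    have "T x = \<mu> *\<^sub>C x" using that by (simp add: G_def)
    then have "(T ^^ n) x = \<mu> ^ n *\<^sub>C x" for n
      by (induction n) (simp_all add: scaleC_one TC scaleC_scaleC mult_ac)
    then have "cmod \<mu> ^ n * norm x \<le> K * norm x" for n
      using K[of n x] by (simp add: norm_scaleC norm_power)
    then have "cmod \<mu> ^ n \<le> K" for n using \<open>x \<noteq> 0\<close> by simp
    moreover obtain n where "K < cmod \<mu> ^ n" using \<mu> real_arch_pow by blast
    ultimately show False by (meson not_le)
  qed
  have inj: "inj G"
  proof (rule injI)
    fix x y assume "G x = G y"
    then have "G (x - y) = 0" by (simp add: bounded_linear.linear[OF blG] linear_diff)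
    then show "x = y" using G0 by force
  qed
  have R: "resolvent \<mu> T = h"
  proof
    fix x
    have "inv G (G (h x)) = h x" using inj by (rule inv_f_f)
    then show "resolvent \<mu> T x = h x"
      unfolding Gh by (simp add: resolvent_def G_def[abs_def])
  qed
  show "\<mu> *\<^sub>C resolvent \<mu> T x - T (resolvent \<mu> T x) = x"
    using Gh[of x] by (simp add: R G_def)
  show "bounded_linear (resolvent \<mu> T)"
    unfolding R
  proof (rule bounded_linear_intro)
    fix x y :: 'a and r :: real
    note linG = bounded_linear.linear[OF blG]
    have "G (h (x + y)) = G (h x + h y)" by (simp add: Gh linear_add[OF linG])
    then show "h (x + y) = h x + h y" using inj by (simp add: inj_eq)
    have "G (h (r *\<^sub>R x)) = G (r *\<^sub>R h x)" by (simp add: Gh linear_scale[OF linG])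
    then show "h (r *\<^sub>R x) = r *\<^sub>R h x" using inj by (simp add: inj_eq)
    have "norm (\<Sum>k. s x k) \<le> (\<Sum>k. (1 / cmod \<mu>) ^ k * (K * norm x))"
      by (rule norm_suminf_le[OF ns gs'])
    also have "\<dots> = norm x * ((\<Sum>k. (1 / cmod \<mu>) ^ k) * K)"
      by (simp only: suminf_mult2[OF gs, symmetric]) (simp add: mult_ac)
    finally have "norm (h x) \<le> (1 / cmod \<mu>) * (norm x * ((\<Sum>k. (1 / cmod \<mu>) ^ k) * K))"
      unfolding h_def norm_scaleC norm_divide norm_one by (rule mult_left_mono) simp
    then show "norm (h x) \<le> norm x * ((1 / cmod \<mu>) * ((\<Sum>k. (1 / cmod \<mu>) ^ k) * K))"
      by (simp add: mult_ac)
  qed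
qed

section \<open>Plancherel estimate for the perturbation\<close>

text \<open>
  With \<open>z\<close> the unilateral shift on sequences, \<open>forced_orbit T\<close> is \<open>(1 - z T)\<inverse>\<close> and
  \<open>perturbation_response T D\<close> is \<open>z (1 - z T)\<inverse> D\<close>, whose symbol on the unit circle is
  \<open>R(\<lambda>, T) D\<close> with \<open>\<lambda> = z\<inverse>\<close>.
\<close>

primrec forced_orbit :: "('a \<Rightarrow> 'a::real_vector) \<Rightarrow> (nat \<Rightarrow> 'a) \<Rightarrow> nat \<Rightarrow> 'a" where
  "forced_orbit T u 0 = u 0"
| "forced_orbit T u (Suc n) = u (Suc n) + T (forced_orbit T u n)"

primrec perturbation_response ::
    "('a \<Rightarrow> 'a::real_vector) \<Rightarrow> ('a \<Rightarrow> 'a) \<Rightarrow> (nat \<Rightarrow> 'a) \<Rightarrow> nat \<Rightarrow> 'a" where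
  "perturbation_response T D u 0 = 0"
| "perturbation_response T D u (Suc n) = T (perturbation_response T D u n) + D (u n)"

lemma perturbation_response_cong:
  "(\<And>k. k < n \<Longrightarrow> u k = v k) \<Longrightarrow> perturbation_response T D u n = perturbation_response T D v n"
  by (induction n) auto

text \<open>
  Inverting the discrete Fourier transform of \<open>R(\<lambda>, T) D\<close> at the points \<open>\<lambda> = r exp(2 \<pi> i j / N)\<close>
  gives the solution of the recursion for \<open>perturbation_response\<close> that is \<open>N\<close>-periodic after
  division by \<open>r\<^sup>m\<close>. Its initial value \<open>x\<^sub>0\<close> need not vanish, but tends to \<open>0\<close> as \<open>N \<rightarrow> \<infinity>\<close>.
\<close>

lemma periodic_response:
  fixes T D :: "'a::complex_inner \<Rightarrow> 'a"
  assumes T: "bounded_clinear T" and D: "bounded_clinear D"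
    and K: "\<And>n x. norm ((T ^^ n) x) \<le> K * norm x"
    and q: "\<And>\<mu> x. cmod \<mu> > 1 \<Longrightarrow> \<exists>y. \<mu> *\<^sub>C y - T y = D x \<and> norm y \<le> q * norm x"
    and r: "r > 1" and N: "n < N"
  obtains x\<^sub>0 where
    "(r ^ N - K) * norm x\<^sub>0 \<le> K * norm (perturbation_response T D u (Suc n))"
    "(\<Sum>m\<le>n. (norm ((T ^^ m) x\<^sub>0 + perturbation_response T D u m) / r ^ m)\<^sup>2)
      \<le> q\<^sup>2 * (\<Sum>k\<le>n. (norm (u k))\<^sup>2)"
proof -
  have linT: "linear T" and TC: "\<And>a x. T (a *\<^sub>C x) = a *\<^sub>C T x"
    using T by (simp_all add: bounded_clinear_def bounded_linear.linear)
  have linD: "linear D" and DC: "\<And>a x. D (a *\<^sub>C x) = a *\<^sub>C D x"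
    using D by (simp_all add: bounded_clinear_def bounded_linear.linear)
  let ?e = "dft_char N"
  \<comment> \<open>Truncation puts the forcing inside one period, since \<open>n < N\<close>. By
    causality the response is unchanged up to time n + 1.\<close>
  define v where "v k = (if k \<le> n then u k else 0)" for k
  define p where "p k = (1 / r ^ k) *\<^sub>R v k" for k
  define p' where "p' j = (\<Sum>k<N. cnj (?e k j) *\<^sub>C p k)" for j
  define \<mu> where "\<mu> j = complex_of_real r * ?e j 1" for j
  have "cmod (\<mu> j) > 1" for j
    using r by (simp add: \<mu>_def norm_mult)
  then have "\<exists>y. \<mu> j *\<^sub>C y - T y = D (p' j) \<and> norm y \<le> q * norm (p' j)" for j
    by (rule q)
  then obtain g where g: "\<And>j. \<mu> j *\<^sub>C g j - T (g j) = D (p' j)"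
    and ng: "\<And>j. norm (g j) \<le> q * norm (p' j)" by metis
  \<comment> \<open>Inverse transform of the solutions \<open>g\<close>, whose data are the
    transform of the forcing damped by r^(-k). Multiplication by r^m later restores the original
    forcing.\<close>
  define w where "w m = (1 / real N) *\<^sub>R (\<Sum>j<N. ?e j m *\<^sub>C g j)" for m
  have N0: "N > 0" using N by simp
  have wN: "w N = w 0" using N0 by (simp add: w_def dft_char_period)
  have inversion: "(\<Sum>j<N. ?e j m *\<^sub>C p' j) = real N *\<^sub>R p m" if "m < N" for m
  proof -
    have "(\<Sum>j<N. ?e j m *\<^sub>C p' j) = (\<Sum>j<N. \<Sum>k<N. (?e m j * cnj (?e k j)) *\<^sub>C p k)"
      by (simp add: p'_def scaleC_sum_right scaleC_scaleC dft_char_commute[of N _ m])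
    also have "\<dots> = (\<Sum>k<N. (\<Sum>j<N. ?e m j * cnj (?e k j)) *\<^sub>C p k)"
      by (subst sum.swap) (simp add: scaleC_sum_left)
    also have "\<dots> = (\<Sum>k<N. if m = k then real N *\<^sub>R p k else 0)"
      using that by (intro sum.cong refl) (simp add: sum_dft_char scaleR_scaleC)
    also have "\<dots> = real N *\<^sub>R p m" using that by simp
    finally show ?thesis .
  qed
  \<comment> \<open>Advancing m by one multiplies the j-th character by \<open>?e j 1\<close>, which
    is \<open>\<mu> j\<close> divided by r. The equation for \<open>g j\<close> thus becomes a
    recursion for \<open>w\<close>.\<close>
  have step: "r *\<^sub>R w (Suc m) = T (w m) + D (p m)" if "m < N" for m
  proof -
    have "?e j (Suc m) *\<^sub>C (r *\<^sub>R x) = ?e j m *\<^sub>C (\<mu> j *\<^sub>C x)" for j and x :: 'a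
      by (simp only: \<mu>_def dft_char_Suc[of N j m] scaleR_scaleC scaleC_scaleC mult_ac)
    then have "r *\<^sub>R w (Suc m) = (1 / real N) *\<^sub>R (\<Sum>j<N. ?e j m *\<^sub>C (\<mu> j *\<^sub>C g j))"
      by (simp only: w_def scaleR_left_commute[of r] scaleR_sum_right[of r] scaleR_scaleC_commute[of r])
    moreover have "T (w m) = (1 / real N) *\<^sub>R (\<Sum>j<N. ?e j m *\<^sub>C T (g j))"
      by (simp only: w_def linear_scale[OF linT] linear_sum[OF linT] TC)
    ultimately have "r *\<^sub>R w (Suc m) - T (w m)
        = (1 / real N) *\<^sub>R (\<Sum>j<N. ?e j m *\<^sub>C (\<mu> j *\<^sub>C g j - T (g j)))"
      by (simp only: scaleC_diff_right sum_subtractf scaleR_diff_right)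
    also have "\<dots> = (1 / real N) *\<^sub>R D (\<Sum>j<N. ?e j m *\<^sub>C p' j)"
      by (simp add: g linear_sum[OF linD] DC)
    also have "\<dots> = D (p m)"
      using N0 that by (simp add: inversion linear_scale[OF linD])
    finally show ?thesis by (simp add: algebra_simps)
  qed
  have orbit: "r ^ m *\<^sub>R w m = (T ^^ m) (w 0) + perturbation_response T D v m" if "m \<le> N" for m
    using that
  proof (induction m)
    case (Suc m)
    have "r ^ Suc m *\<^sub>R w (Suc m) = r ^ m *\<^sub>R (r *\<^sub>R w (Suc m))" by (simp add: mult.commute)
    also have "\<dots> = T (r ^ m *\<^sub>R w m) + D (r ^ m *\<^sub>R p m)"
      using Suc.prems by (simp add: step scaleR_add_right linear_scale[OF linT] linear_scale[OF linD])
    also have "r ^ m *\<^sub>R p m = v m" using r by (simp add: p_def)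
    finally show ?case using Suc by (simp add: linear_add[OF linT])
  qed simp
  have vu: "perturbation_response T D v m = perturbation_response T D u m" if "m \<le> Suc n" for m
    using that by (intro perturbation_response_cong) (simp add: v_def)
  \<comment> \<open>After time n the forcing is zero and the response evolves under T alone, so K
    bounds it independently of N.\<close>
  have tail: "perturbation_response T D v (Suc n + i) = (T ^^ i) (perturbation_response T D u (Suc n))" for i
  proof (induction i)
    case 0
    show ?case using vu[of "Suc n"] by (simp only: add_0_right funpow_0 order_refl)
  next
    case (Suc i)
    then show ?case by (simp add: v_def linear_0[OF linD] del: perturbation_response.simps(2)
        add: perturbation_response.simps(2)[of _ _ _ "Suc n + i", simplified add_Suc])
  qed
  have nw: "norm (w m) = norm ((T ^^ m) (w 0) + perturbation_response T D u m) / r ^ m" if "m \<le> n" for m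
  proof -
    have "r ^ m * norm (w m) = norm (r ^ m *\<^sub>R w m)" using r by simp
    also have "\<dots> = norm ((T ^^ m) (w 0) + perturbation_response T D u m)"
      using that N by (simp add: orbit vu)
    finally show ?thesis using r by (simp add: field_simps)
  qed
  show thesis
  proof
    \<comment> \<open>Periodicity closes the orbit: r^N \<open>w 0\<close> equals T^N
      \<open>w 0\<close> plus the response at time N. Since T^N costs only a factor K, the initial
      value is small for large N.\<close>
    have "r ^ N * norm (w 0) = norm (r ^ N *\<^sub>R w N)" using r by (simp add: wN)
    also have "\<dots> \<le> norm ((T ^^ N) (w 0)) + norm (perturbation_response T D v N)"
      by (simp add: orbit norm_triangle_ineq)
    also have "norm ((T ^^ N) (w 0)) \<le> K * norm (w 0)" by (rule K)
    also have "norm (perturbation_response T D v N) \<le> K * norm (perturbation_response T D u (Suc n))"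
      using tail[of "N - Suc n"] N K by simp
    finally show "(r ^ N - K) * norm (w 0) \<le> K * norm (perturbation_response T D u (Suc n))"
      by (simp add: algebra_simps)
    have "(\<Sum>m\<le>n. (norm ((T ^^ m) (w 0) + perturbation_response T D u m) / r ^ m)\<^sup>2)
        = (\<Sum>m\<le>n. (norm (w m))\<^sup>2)"
      by (simp add: nw)
    also have "\<dots> \<le> (\<Sum>m<N. (norm (w m))\<^sup>2)"
      using N by (intro sum_mono2) auto
    also have "\<dots> = (1 / real N)\<^sup>2 * (\<Sum>m<N. (norm (\<Sum>j<N. ?e j m *\<^sub>C g j))\<^sup>2)"
      by (simp add: w_def power_mult_distrib sum_distrib_left power_divide)
    also have "\<dots> = (1 / real N)\<^sup>2 * (real N * (\<Sum>j<N. (norm (g j))\<^sup>2))"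
      by (subst parseval_orthogonal[of N _ "real N"]) (simp_all add: sum_dft_char)
    also have "\<dots> \<le> (1 / real N)\<^sup>2 * (real N * (\<Sum>j<N. (q * norm (p' j))\<^sup>2))"
      by (intro mult_left_mono sum_mono power_mono ng) simp_all
    also have "\<dots> = q\<^sup>2 / real N * (\<Sum>j<N. (norm (p' j))\<^sup>2)"
      unfolding power_mult_distrib sum_distrib_left[symmetric] by (simp add: power2_eq_square)
    also have "(\<Sum>j<N. (norm (p' j))\<^sup>2) = real N * (\<Sum>k<N. (norm (p k))\<^sup>2)"
      unfolding p'_def
    proof (rule parseval_orthogonal)
      fix i j assume "i < N" "j < N"
      then show "(\<Sum>m<N. cnj (?e i m) * cnj (cnj (?e j m))) = (if i = j then complex_of_real (real N) else 0)"
        using sum_dft_char[of j N i] by (auto simp: mult.commute)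
    qed
    also have "(\<Sum>k<N. (norm (p k))\<^sup>2) = (\<Sum>k\<le>n. (norm (p k))\<^sup>2)"
      using N by (intro sum.mono_neutral_right) (auto simp: p_def v_def)
    also have "q\<^sup>2 / real N * (real N * (\<Sum>k\<le>n. (norm (p k))\<^sup>2)) = q\<^sup>2 * (\<Sum>k\<le>n. (norm (p k))\<^sup>2)"
      using N0 by simp
    also have "\<dots> \<le> q\<^sup>2 * (\<Sum>k\<le>n. (norm (u k))\<^sup>2)"
    proof (intro mult_left_mono sum_mono power_mono)
      fix k assume "k \<in> {..n}"
      then have "norm (p k) = norm (u k) / r ^ k" using r by (simp add: p_def v_def)
      also have "\<dots> \<le> norm (u k) / 1" using r by (intro divide_left_mono) auto
      finally show "norm (p k) \<le> norm (u k)" by simp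
    qed simp_all
    finally show "(\<Sum>m\<le>n. (norm ((T ^^ m) (w 0) + perturbation_response T D u m) / r ^ m)\<^sup>2)
      \<le> q\<^sup>2 * (\<Sum>k\<le>n. (norm (u k))\<^sup>2)" .
  qed
qed

text \<open>In \<open>periodic_response\<close> the right-hand sides do not depend on N while r^N -
  K tends to infinity, so the free part T^m x disappears as N grows. The damping r^(-m), forced by
  the resolvent bound holding only outside the closed disc, is then removed along r = 1 +
  1/(i+1).\<close>

lemma perturbation_response_L2_bound:
  fixes T D :: "'a::complex_inner \<Rightarrow> 'a"
  assumes T: "bounded_clinear T" and D: "bounded_clinear D"
    and K: "\<And>n x. norm ((T ^^ n) x) \<le> K * norm x"
    and q: "\<And>\<mu> x. cmod \<mu> > 1 \<Longrightarrow> \<exists>y. \<mu> *\<^sub>C y - T y = D x \<and> norm y \<le> q * norm x"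
    and q0: "q \<ge> 0"
  shows "L2_set (\<lambda>m. norm (perturbation_response T D u m)) {..n} \<le> q * L2_set (\<lambda>k. norm (u k)) {..n}"
proof -
  let ?W = "perturbation_response T D u"
  let ?B = "q\<^sup>2 * (\<Sum>k\<le>n. (norm (u k))\<^sup>2)"
  have bl: "bounded_linear (T ^^ m)" for m
    using T by (intro funpow_bounded_linear) (simp add: bounded_clinear_def)
  have weighted: "(\<Sum>m\<le>n. (norm (?W m) / r ^ m)\<^sup>2) \<le> ?B" if r: "r > 1" for r
  proof -
    have "\<forall>N. \<exists>x. n < N \<longrightarrow> (r ^ N - K) * norm x \<le> K * norm (?W (Suc n)) \<and>
        (\<Sum>m\<le>n. (norm ((T ^^ m) x + ?W m) / r ^ m)\<^sup>2) \<le> ?B"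
    proof
      fix N
      show "\<exists>x. n < N \<longrightarrow> (r ^ N - K) * norm x \<le> K * norm (?W (Suc n)) \<and>
        (\<Sum>m\<le>n. (norm ((T ^^ m) x + ?W m) / r ^ m)\<^sup>2) \<le> ?B"
      proof (cases "n < N")
        case True
        show ?thesis by (rule periodic_response[OF T D K q r True, of u]; blast)
      qed simp
    qed
    from choice[OF this] obtain x where
      x1: "\<And>N. N > n \<Longrightarrow> (r ^ N - K) * norm (x N) \<le> K * norm (?W (Suc n))"
      and x2: "\<And>N. N > n \<Longrightarrow> (\<Sum>m\<le>n. (norm ((T ^^ m) (x N) + ?W m) / r ^ m)\<^sup>2) \<le> ?B"
      by blast
    have "filterlim (\<lambda>N. r ^ N) at_top sequentially"
      using r by (intro filterlim_at_infinity_imp_filterlim_at_top filterlim_realpow_sequentially_gt1)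
        auto
    then have rN: "filterlim (\<lambda>N. r ^ N - K) at_top sequentially"
      using filterlim_tendsto_add_at_top[OF tendsto_const[of "- K"]] by fastforce
    have bound_0: "(\<lambda>N. K * norm (?W (Suc n)) / (r ^ N - K)) \<longlonglongrightarrow> 0"
      by (rule real_tendsto_divide_at_top[OF tendsto_const rN])
    have "\<forall>\<^sub>F N in sequentially. norm (x N) \<le> K * norm (?W (Suc n)) / (r ^ N - K)"
      using eventually_gt_at_top[of n] filterlim_at_top_dense[THEN iffD1, OF rN, rule_format, of 0]
      by eventually_elim (use x1 in \<open>simp add: pos_le_divide_eq mult.commute\<close>)
    from Lim_null_comparison[OF this bound_0] have x0: "x \<longlonglongrightarrow> 0" .
    have "(\<lambda>N. (T ^^ m) (x N)) \<longlonglongrightarrow> 0" for m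
      using bounded_linear.tendsto_zero[OF bl x0] .
    then have "(\<lambda>N. (\<Sum>m\<le>n. (norm ((T ^^ m) (x N) + ?W m) / r ^ m)\<^sup>2))
        \<longlonglongrightarrow> (\<Sum>m\<le>n. (norm (0 + ?W m) / r ^ m)\<^sup>2)"
      using r by (intro tendsto_intros) auto
    then have "(\<Sum>m\<le>n. (norm (0 + ?W m) / r ^ m)\<^sup>2) \<le> ?B"
      by (rule LIMSEQ_le_const2) (use x2 in \<open>auto intro: exI[of _ "Suc n"]\<close>)
    then show ?thesis by simp
  qed
  have "(\<lambda>i. (\<Sum>m\<le>n. (norm (?W m) / (1 + inverse (real (Suc i))) ^ m)\<^sup>2))
      \<longlonglongrightarrow> (\<Sum>m\<le>n. (norm (?W m) / (1 + 0) ^ m)\<^sup>2)"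
    by (intro tendsto_intros LIMSEQ_inverse_real_of_nat) simp
  then have "(\<Sum>m\<le>n. (norm (?W m) / (1 + 0) ^ m)\<^sup>2) \<le> ?B"
    by (rule LIMSEQ_le_const2) (auto intro!: exI[of _ 0] weighted simp del: of_nat_Suc)
  then have "L2_set (\<lambda>m. norm (?W m)) {..n} \<le> sqrt ?B"
    by (simp add: L2_set_def)
  also have "\<dots> = q * L2_set (\<lambda>k. norm (u k)) {..n}"
    using q0 by (simp add: L2_set_def real_sqrt_mult)
  finally show ?thesis .
qed

section \<open>Powers of the perturbed operator\<close>

lemma forced_orbit_commute:
  assumes T: "linear T" and A: "linear A" and comm: "\<And>x. T (A x) = A (T x)"
  shows "forced_orbit T (forced_orbit A u) = forced_orbit A (forced_orbit T u)"
proof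
  fix n
  let ?a = "forced_orbit A u" and ?t = "forced_orbit T u"
  \<comment> \<open>The second conjunct is the claimed equality at n + 1 with u (n + 1) cancelled.
    Applying A and T to it yields its own successor case.\<close>
  have "forced_orbit T ?a n = forced_orbit A ?t n \<and>
      A (?a n) + T (forced_orbit T ?a n) = T (?t n) + A (forced_orbit A ?t n)"
  proof (induction n)
    case (Suc n)
    then have eq: "forced_orbit T ?a n = forced_orbit A ?t n"
      and sum_eq: "A (?a n) + T (forced_orbit A ?t n) = T (?t n) + A (forced_orbit A ?t n)" by auto
    from arg_cong[OF sum_eq, of A] arg_cong[OF sum_eq, of T]
    have "A (A (?a n)) + A (T (forced_orbit A ?t n)) = A (T (?t n)) + A (A (forced_orbit A ?t n))"
      and "A (T (?a n)) + T (T (forced_orbit A ?t n)) = T (T (?t n)) + A (T (forced_orbit A ?t n))"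
      by (simp_all only: linear_add[OF T] linear_add[OF A] comm)
    with eq sum_eq show ?case
      by (simp add: linear_add[OF T] linear_add[OF A] comm algebra_simps)
  qed simp
  then show "forced_orbit T ?a n = forced_orbit A ?t n" ..
qed

text \<open>Resolvent identity (1 - zA)^-1 = (1 - zT)^-1 + W (1 - zA)^-1, which exhibits the
  perturbed orbit as a fixed point to which \<open>seq_norm_fixpoint\<close> applies.\<close>

lemma forced_orbit_perturbed:
  assumes "linear T"
  shows "forced_orbit (\<lambda>x. T x + D x) u n
    = forced_orbit T u n + perturbation_response T D (forced_orbit (\<lambda>x. T x + D x) u) n"
  using linear_add[OF assms] by (induction n) (auto simp: algebra_simps)

text \<open>Here \<open>c = (1 - W)\<inverse> b\<close>.\<close>

lemma forced_orbit_perturbed':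
  assumes T: "linear T" and D: "linear D" and comm: "\<And>x. D (T x) = T (D x)"
  obtains c where "\<And>n. c n = b n + perturbation_response T D c n"
    and "forced_orbit (\<lambda>x. T x + D x) b = forced_orbit T c"
proof -
  let ?A = "\<lambda>x. T x + D x"
  \<comment> \<open>The witness is (1 - zT)(1 - zA)^-1 b = b + zD (1 - zA)^-1 b, because 1 - zT = (1
    - zA) + zD. Commutation of D with T then gives W c = zD (1 - zA)^-1 b.\<close>
  define c where "c n = (case n of 0 \<Rightarrow> b 0 | Suc k \<Rightarrow> b (Suc k) + D (forced_orbit ?A b k))" for n
  have c_simps [simp]: "c 0 = b 0" "\<And>k. c (Suc k) = b (Suc k) + D (forced_orbit ?A b k)"
    by (simp_all add: c_def)
  have W: "perturbation_response T D c (Suc n) = D (forced_orbit ?A b n)" for n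
  proof (induction n)
    case (Suc n)
    then show ?case
      by (simp add: linear_add[OF T] linear_add[OF D] comm algebra_simps)
  qed (simp add: linear_0[OF T])
  show thesis
  proof
    show "c n = b n + perturbation_response T D c n" for n
      by (cases n) (simp_all only: W c_simps, simp)
    have "forced_orbit ?A b n = forced_orbit T c n" for n
      by (induction n) (simp_all add: algebra_simps)
    then show "forced_orbit ?A b = forced_orbit T c" by blast
  qed
qed

text \<open>Variation of constants writes the orbit as a convolution with the powers of T.
  Cauchy-Schwarz against the constant sequence K produces the square root.\<close>

lemma norm_forced_orbit_le:
  assumes T: "linear T" and K: "\<And>n x. norm ((T ^^ n) x) \<le> K * norm x" and "K \<ge> 0"
  shows "norm (forced_orbit T c n) \<le> K * sqrt (real n + 1) * L2_set (\<lambda>k. norm (c k)) {..n}"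
proof -
  have "forced_orbit T c n = (\<Sum>k\<le>n. (T ^^ (n - k)) (c k))"
  proof (induction n)
    case (Suc n)
    have "T (\<Sum>k\<le>n. (T ^^ (n - k)) (c k)) = (\<Sum>k\<le>n. (T ^^ (Suc n - k)) (c k))"
      by (simp add: linear_sum[OF T] Suc_diff_le)
    with Suc show ?case by (simp add: add.commute)
  qed simp
  also have "norm \<dots> \<le> (\<Sum>k\<le>n. K * norm (c k))"
    by (intro sum_norm_le K)
  also have "\<dots> = (\<Sum>k\<le>n. \<bar>K\<bar> * \<bar>norm (c k)\<bar>)"
    using \<open>K \<ge> 0\<close> by simp
  also have "\<dots> \<le> L2_set (\<lambda>_. K) {..n} * L2_set (\<lambda>k. norm (c k)) {..n}"
    by (rule L2_set_mult_ineq)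
  finally show ?thesis
    using \<open>K \<ge> 0\<close> by (simp add: L2_set_constant mult_ac add.commute)
qed

text \<open>This is the negative binomial series of (1 - zA)^(-p-1) applied to x placed at time 0;
  Pascal's rule drives the inner induction.\<close>

lemma funpow_forced_orbit_single:
  assumes A: "linear A"
  shows "(forced_orbit A ^^ Suc p) (\<lambda>k. if k = 0 then x else 0) j
    = real ((j + p) choose p) *\<^sub>R (A ^^ j) x"
proof (induction p arbitrary: j)
  case 0
  show ?case by (induction j) (simp_all)
next
  case (Suc p)
  show ?case
  proof (induction j)
    case 0
    then show ?case using Suc[of 0] by simp
  next
    case (Suc j)
    have "(forced_orbit A ^^ Suc (Suc p)) (\<lambda>k. if k = 0 then x else 0) (Suc j)
      = real ((Suc j + p) choose p) *\<^sub>R (A ^^ Suc j) x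
        + A (real ((j + Suc p) choose Suc p) *\<^sub>R (A ^^ j) x)"
      using Suc.IH \<open>\<And>j. (forced_orbit A ^^ Suc p) _ j = _\<close>[of "Suc j"]
      by (simp only: funpow.simps(2)[of "Suc p"] o_apply forced_orbit.simps(2))
    also have "\<dots> = real ((Suc j + Suc p) choose Suc p) *\<^sub>R (A ^^ Suc j) x"
      by (simp add: linear_scale[OF A] scaleR_add_left[symmetric])
    finally show ?case .
  qed
qed

text \<open>The resolvent bound is phrased as solvability with an estimate, the form in which
  \<open>periodic_response\<close> uses it; this keeps \<open>resolvent\<close> out of the
  estimates.\<close>

locale small_resolvent_perturbation =
  fixes T D :: "'a::complex_inner \<Rightarrow> 'a" and K q :: real
  assumes T: "bounded_clinear T" and D: "bounded_clinear D"
    and comm: "D (T x) = T (D x)"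
    and K: "norm ((T ^^ n) x) \<le> K * norm x"
    and q: "cmod \<mu> > 1 \<Longrightarrow> \<exists>y. \<mu> *\<^sub>C y - T y = D x \<and> norm y \<le> q * norm x"
    and q_nonneg: "0 \<le> q" and q_less: "q < 1" and K_nonneg: "0 \<le> K"
begin

abbreviation "A \<equiv> \<lambda>x. T x + D x"

abbreviation seq_norm :: "nat \<Rightarrow> (nat \<Rightarrow> 'a) \<Rightarrow> real"
  where "seq_norm n u \<equiv> L2_set (\<lambda>k. norm (u k)) {..n}"

lemma linear_T: "linear T" and linear_D: "linear D" and linear_A: "linear A"
proof -
  show "linear T" "linear D"
    using T D by (simp_all add: bounded_clinear_def bounded_linear.linear)
  then show "linear A" by (rule linear_compose_add)
qed

text \<open>The norm of W c is at most q times that of c and is absorbed on the left, as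
  \<open>q < 1\<close> and the truncated norms are finite.\<close>

lemma seq_norm_fixpoint:
  assumes "\<And>n. c n = b n + perturbation_response T D c n"
  shows "seq_norm n c \<le> seq_norm n b / (1 - q)"
proof -
  have "seq_norm n c \<le> L2_set (\<lambda>k. norm (b k) + norm (perturbation_response T D c k)) {..n}"
    by (intro L2_set_mono) (metis assms norm_triangle_ineq, simp)
  also have "\<dots> \<le> seq_norm n b + seq_norm n (perturbation_response T D c)"
    by (rule L2_set_triangle_ineq)
  also have "seq_norm n (perturbation_response T D c) \<le> q * seq_norm n c"
    using perturbation_response_L2_bound[OF T D K q q_nonneg] .
  finally show ?thesis
    using q_less by (simp add: pos_le_divide_eq algebra_simps)
qed

text \<open>Each step trades one factor (1 - zA)^-1 for (1 - zT)^-1 at the cost 1 / (1 - q). Since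
  the two commute, the remaining factors act on the T-orbit of u, hence the induction over arbitrary
  \<open>u\<close>.\<close>

lemma seq_norm_funpow_forced_orbit:
  "seq_norm n ((forced_orbit A ^^ i) u) \<le> seq_norm n ((forced_orbit T ^^ i) u) / (1 - q) ^ i"
proof (induction i arbitrary: u)
  case (Suc i)
  have TA: "T (A x) = A (T x)" for x
    using linear_add[OF linear_T] by (simp add: comm)
  have swap: "forced_orbit T ((forced_orbit A ^^ i) u) = (forced_orbit A ^^ i) (forced_orbit T u)"
  proof (induction i)
    case (Suc i)
    have "forced_orbit T (forced_orbit A v) = forced_orbit A (forced_orbit T v)" for v
      by (rule forced_orbit_commute[OF linear_T linear_A, OF TA])
    with Suc show ?case unfolding funpow.simps(2) o_apply by metis
  qed simp
  have "seq_norm n ((forced_orbit A ^^ Suc i) u)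
      \<le> seq_norm n ((forced_orbit A ^^ i) (forced_orbit T u)) / (1 - q)"
    unfolding swap[symmetric] funpow.simps(2) o_apply
    by (rule seq_norm_fixpoint) (rule forced_orbit_perturbed[OF linear_T])
  also have "\<dots> \<le> seq_norm n ((forced_orbit T ^^ i) (forced_orbit T u)) / (1 - q) ^ i / (1 - q)"
    using q_less by (intro divide_right_mono Suc) simp
  finally show ?case
    by (simp add: funpow_swap1 mult.commute)
qed simp

text \<open>The first p + 1 factors are estimated in the truncated l2 norm and the last one
  pointwise, which together cost p + 2 factors 1 / (1 - q). One square root of n + 1 comes from
  Cauchy-Schwarz, the other from the l2 norm of the constant B.\<close>

lemma norm_funpow_perturbed_le:
  assumes B: "\<And>j. j \<le> n \<Longrightarrow> real ((j + p) choose p) * norm ((T ^^ j) x) \<le> B"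
  shows "real ((n + Suc p) choose Suc p) * norm ((A ^^ n) x)
    \<le> K / (1 - q) ^ (p + 2) * (real n + 1) * B"
proof -
  let ?d = "\<lambda>k::nat. if k = 0 then x else 0"
  let ?b = "(forced_orbit A ^^ Suc p) ?d"
  obtain c where c: "\<And>n. c n = ?b n + perturbation_response T D c n"
    and Ac: "forced_orbit A ?b = forced_orbit T c"
    using forced_orbit_perturbed'[OF linear_T linear_D comm] by blast
  have "real ((n + Suc p) choose Suc p) * norm ((A ^^ n) x) = norm (forced_orbit A ?b n)"
    using arg_cong[OF funpow_forced_orbit_single[OF linear_A, of "Suc p" x n], of norm]
    by (simp only: funpow.simps(2)[of "Suc p"] o_apply norm_scaleR abs_of_nat)
  also have "\<dots> \<le> K * sqrt (real n + 1) * seq_norm n c"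
    unfolding Ac by (rule norm_forced_orbit_le[OF linear_T K K_nonneg])
  also have "\<dots> \<le> K * sqrt (real n + 1) * (seq_norm n ?b / (1 - q))"
    using K_nonneg by (intro mult_left_mono seq_norm_fixpoint c) simp
  also have "\<dots> \<le> K * sqrt (real n + 1) * (seq_norm n ((forced_orbit T ^^ Suc p) ?d) / (1 - q) ^ Suc p / (1 - q))"
    using K_nonneg q_less by (intro mult_left_mono divide_right_mono seq_norm_funpow_forced_orbit) simp_all
  also have "\<dots> \<le> K * sqrt (real n + 1) * (L2_set (\<lambda>_. B) {..n} / (1 - q) ^ Suc p / (1 - q))"
    using K_nonneg q_less B
    by (intro mult_left_mono divide_right_mono L2_set_mono)
       (simp_all only: funpow_forced_orbit_single[OF linear_T] norm_scaleR, simp_all)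
  also have "L2_set (\<lambda>_. B) {..n} = sqrt (real n + 1) * B"
  proof -
    have "0 \<le> B" using B[of 0] by (simp add: order_trans[OF norm_ge_zero])
    then show ?thesis by (simp add: L2_set_constant add.commute)
  qed
  also have "K * sqrt (real n + 1) * (sqrt (real n + 1) * B / (1 - q) ^ Suc p / (1 - q))
      = K / (1 - q) ^ (p + 2) * (sqrt (real n + 1) * sqrt (real n + 1)) * B"
    by (simp add: mult_ac)
  also have "sqrt (real n + 1) * sqrt (real n + 1) = real n + 1"
    by simp
  finally show ?thesis .
qed

end

section \<open>Bounded regularly varying functions\<close>

text \<open>
  In a fine tagged division, the increments tagged in the exceptional null set are small by absolute
  continuity and the others by the sign of the derivative.
\<close>

lemma absolutely_continuous_increment_le:
  fixes h \<phi> :: "real \<Rightarrow> real"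
  assumes ab: "a \<le> b" and ac: "absolutely_continuous_on {a..b} h" and mono: "mono_on {a..b} \<phi>"
    and ae: "AE t in lebesgue. t \<in> {a..b} \<longrightarrow>
      (\<exists>l\<le>0. ((\<lambda>s. h s - \<phi> s) has_real_derivative l) (at t within {a..b}))"
  shows "h b - h a \<le> \<phi> b - \<phi> a"
proof (rule field_le_epsilon)
  fix e :: real assume "e > 0"
  define g where "g s = h s - \<phi> s" for s
  \<comment> \<open>This slope leaves at most e / 2 for the intervals tagged outside E; the added 1
    keeps the denominator positive when a = b.\<close>
  define e' where "e' = e / (2 * (b - a + 1))"
  have e': "e' > 0" using \<open>e > 0\<close> ab by (simp add: e'_def)
  obtain E where E: "E \<in> null_sets lebesgue"
    and good: "\<And>t. t \<in> {a..b} - E \<Longrightarrow> \<exists>l\<le>0. (g has_real_derivative l) (at t within {a..b})"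
    using ae unfolding eventually_ae_filter g_def[symmetric] by (auto simp: subset_iff) blast
  obtain \<delta> where \<delta>: "\<delta> > 0" and \<delta>_bound: "\<And>d. d division_of \<Union>d \<Longrightarrow> \<Union>d \<subseteq> {a..b} \<Longrightarrow>
      (\<Sum>k\<in>d. Sup k - Inf k) < \<delta> \<Longrightarrow> (\<Sum>k\<in>d. \<bar>h (Sup k) - h (Inf k)\<bar>) < e / 2"
    using ac[unfolded absolutely_continuous_on_def, rule_format, of "e / 2"] \<open>e > 0\<close> by auto
  have E_sets: "E \<in> sets lebesgue" using E by auto
  \<comment> \<open>By outer regularity the null set lies in an open set of measure below \<delta>,
    which bounds the total length of the intervals tagged in E.\<close>
  obtain U where U: "open U" "E \<subseteq> U" "emeasure lebesgue (U - E) < ennreal \<delta>"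
    using sets_lebesgue_outer_open[OF E_sets \<delta>] by metis
  have U_sets: "U \<in> sets lebesgue" using U(1) by auto
  have U_small: "emeasure lebesgue U < ennreal \<delta>"
    using U(3) by (simp add: emeasure_Diff_null_set[OF E U_sets])
  then have U_meas: "U \<in> lmeasurable"
    using U_sets by (intro fmeasurableI) (auto intro: order.strict_trans)
  have U_measure: "measure lebesgue U < \<delta>"
    using U_small \<delta> by (simp add: emeasure_eq_measure2[OF U_meas] ennreal_less_iff)
  \<comment> \<open>Straddle estimate: for u \<le> t \<le> v the errors at both ends add up to e' (v
    - u), while the linear terms contribute l (v - u) \<le> 0.\<close>
  have "\<exists>d>0. \<forall>u v. u \<in> {a..b} \<and> v \<in> {a..b} \<and> u \<le> t \<and> t \<le> v \<and> t - u < d \<and> v - t < d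
      \<longrightarrow> g v - g u \<le> e' * (v - u)" if t: "t \<in> {a..b} - E" for t
  proof -
    obtain l where l: "l \<le> 0" "(g has_real_derivative l) (at t within {a..b})"
      using good[OF t] by blast
    then obtain d where d: "d > 0" and dd: "\<And>y. y \<in> {a..b} \<Longrightarrow> \<bar>y - t\<bar> < d \<Longrightarrow>
        \<bar>g y - g t - l * (y - t)\<bar> \<le> e' * \<bar>y - t\<bar>"
      using e' unfolding has_field_derivative_def has_derivative_within_alt by (auto simp: real_norm_def)
    show ?thesis
    proof (intro exI[of _ d] conjI d allI impI)
      fix u v assume uv: "u \<in> {a..b} \<and> v \<in> {a..b} \<and> u \<le> t \<and> t \<le> v \<and> t - u < d \<and> v - t < d"
      have "g v - g t - l * (v - t) \<le> e' * (v - t)"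
        using dd[of v] uv by auto
      moreover have "g t - g u + l * (u - t) \<le> e' * (t - u)"
        using dd[of u] uv by auto
      moreover have "l * (v - t) \<le> 0" "l * (u - t) \<ge> 0"
        using l(1) uv by (auto intro: mult_nonpos_nonneg mult_nonpos_nonpos)
      ultimately show "g v - g u \<le> e' * (v - u)"
        by (simp add: algebra_simps)
    qed
  qed
  then obtain d where d: "\<And>t. t \<in> {a..b} - E \<Longrightarrow> d t > 0"
    and d_bound: "\<And>t u v. \<lbrakk>t \<in> {a..b} - E; u \<in> {a..b}; v \<in> {a..b}; u \<le> t; t \<le> v; t - u < d t; v - t < d t\<rbrakk>
      \<Longrightarrow> g v - g u \<le> e' * (v - u)"
    by metis
  \<comment> \<open>Tags in E force their intervals into U; the other tags in [a, b] make the
    straddle estimate applicable.\<close>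
  define \<gamma> where "\<gamma> t = (if t \<in> E then U else if t \<in> {a..b} then ball t (d t) else ball t 1)" for t
  have "gauge \<gamma>"
    using U d by (auto simp: gauge_def \<gamma>_def)
  then obtain p where p: "p tagged_division_of {a..b}" and fine: "\<gamma> fine p"
    by (rule fine_division_exists_real)
  have fin: "finite p" using p by (rule tagged_division_of_finite)
  have interval: "\<exists>u v. K = {u..v} \<and> u \<le> x \<and> x \<le> v \<and> a \<le> u \<and> v \<le> b \<and> Inf K = u \<and> Sup K = v
      \<and> K \<subseteq> \<gamma> x" if xK: "(x, K) \<in> p" for x K
  proof -
    obtain u v where K: "K = {u..v}" using tagged_division_ofD(4)[OF p xK] by (auto simp: box_real)
    moreover have "x \<in> K" "K \<subseteq> {a..b}" using tagged_division_ofD(2,3)[OF p xK] by auto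
    moreover have "K \<subseteq> \<gamma> x" using fine xK by (auto simp: fine_def)
    ultimately show ?thesis by auto
  qed
  define p1 where "p1 = {(x, K) \<in> p. x \<in> E}"
  have p1p: "p1 \<subseteq> p" by (auto simp: p1_def)
  have p1_partial: "p1 tagged_partial_division_of {a..b}"
    using p p1p by (meson tagged_division_of_def tagged_partial_division_subset)
  have bad: "(\<Sum>(x, K)\<in>p1. g (Sup K) - g (Inf K)) \<le> e / 2"
  proof -
    let ?d = "snd ` p1"
    \<comment> \<open>Dropping the tags requires a function of the interval that vanishes on
      degenerate intervals, including the empty one.\<close>
    define F where "F K = (if K = {} then 0 else \<bar>h (Sup K) - h (Inf K)\<bar>)" for K
    have div: "?d division_of \<Union>?d"
      by (rule partial_division_of_tagged_division[OF p1_partial])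
    have ne: "K \<noteq> {}" if "K \<in> ?d" for K
      using that interval p1p by fastforce
    have "(\<Sum>(x, K)\<in>p1. g (Sup K) - g (Inf K)) \<le> (\<Sum>(x, K)\<in>p1. F K)"
    proof (rule sum_mono, clarify)
      fix x K assume "(x, K) \<in> p1"
      with interval p1p obtain u v where "K = {u..v}" "u \<le> v" "a \<le> u" "v \<le> b" "Inf K = u" "Sup K = v"
        by (smt (verit) subsetD)
      moreover from this have "\<phi> u \<le> \<phi> v" using mono by (auto simp: mono_on_def)
      ultimately show "g (Sup K) - g (Inf K) \<le> F K"
        by (auto simp: g_def F_def)
    qed
    also have "\<dots> = sum F ?d"
    proof (rule sum.over_tagged_division_lemma[OF tagged_partial_division_of_Union_self[OF p1_partial]])
      fix u v :: real assume "box u v = {}"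
      then have "v \<le> u" by (simp add: box_real)
      then show "F (cbox u v) = 0" by (cases "u = v") (auto simp: F_def box_real)
    qed
    also have "\<dots> = (\<Sum>K\<in>?d. \<bar>h (Sup K) - h (Inf K)\<bar>)"
      using ne by (intro sum.cong) (auto simp: F_def)
    also have "\<dots> < e / 2"
    proof (rule \<delta>_bound[OF div])
      have "K \<subseteq> {a..b}" if "(x, K) \<in> p1" for x K
        using tagged_partial_division_ofD(3)[OF p1_partial that] .
      then show "\<Union>?d \<subseteq> {a..b}" by (auto simp: subset_iff)
      have "\<Union>?d \<subseteq> U"
      proof -
        have "K \<subseteq> U" if "(x, K) \<in> p1" for x K
          using interval[of x K] that by (auto simp: p1_def \<gamma>_def)
        then show ?thesis by (auto simp: subset_iff)
      qed
      have "(\<Sum>K\<in>?d. Sup K - Inf K) = (\<Sum>K\<in>?d. measure lebesgue K)"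
      proof (intro sum.cong refl)
        fix K assume "K \<in> ?d"
        then obtain x where "(x, K) \<in> p" using p1p by auto
        from interval[OF this] obtain u v where "K = {u..v}" "u \<le> x" "x \<le> v"
          by blast
        then show "Sup K - Inf K = measure lebesgue K" by simp
      qed
      also have "\<dots> = measure lebesgue (\<Union>?d)"
        by (rule content_division[OF div])
      also have "\<dots> \<le> measure lebesgue U"
        using \<open>\<Union>?d \<subseteq> U\<close> U_meas lmeasurable_division[OF div]
        by (intro measure_mono_fmeasurable) auto
      finally show "(\<Sum>K\<in>?d. Sup K - Inf K) < \<delta>" using U_measure by simp
    qed
    finally show ?thesis by simp
  qed
  have "(\<Sum>(x, K)\<in>p - p1. g (Sup K) - g (Inf K)) \<le> (\<Sum>(x, K)\<in>p - p1. e' * measure lborel K)"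
  proof (rule sum_mono, clarify)
    fix x K assume xK: "(x, K) \<in> p" "(x, K) \<notin> p1"
    then have "x \<notin> E" by (auto simp: p1_def)
    obtain u v where uv: "K = {u..v}" "u \<le> x" "x \<le> v" "a \<le> u" "v \<le> b" "Inf K = u" "Sup K = v"
      "K \<subseteq> \<gamma> x" using interval[OF xK(1)] by blast
    then have "\<gamma> x = ball x (d x)" using \<open>x \<notin> E\<close> by (simp add: \<gamma>_def)
    moreover have "u \<in> K" "v \<in> K" using uv by auto
    ultimately have "u \<in> ball x (d x)" "v \<in> ball x (d x)" using uv(8) by auto
    then have "x - u < d x" "v - x < d x" using uv(2,3) by (auto simp: dist_real_def)
    then have "g v - g u \<le> e' * (v - u)"
      using uv \<open>x \<notin> E\<close> by (intro d_bound[of x]) auto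
    then show "g (Sup K) - g (Inf K) \<le> e' * measure lborel K"
      using uv by auto
  qed
  also have "\<dots> \<le> (\<Sum>(x, K)\<in>p. e' * measure lborel K)"
    using fin e' by (intro sum_mono2) auto
  also have "\<dots> = e' * (\<Sum>(x, K)\<in>p. measure lborel K)"
    by (simp add: sum_distrib_left case_prod_unfold)
  also have "\<dots> = e' * (b - a)"
    using additive_content_tagged_division[of p a b] p ab by (simp add: box_real)
  also have "\<dots> \<le> e / 2"
    using \<open>e > 0\<close> ab by (simp add: e'_def field_simps)
  finally have "(\<Sum>(x, K)\<in>p - p1. g (Sup K) - g (Inf K)) \<le> e / 2" .
  with bad have "(\<Sum>(x, K)\<in>p. g (Sup K) - g (Inf K)) \<le> e"
    using sum.subset_diff[OF p1p fin, of "\<lambda>(x, K). g (Sup K) - g (Inf K)"] by linarith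
  then have "g b - g a \<le> e"
    using additive_tagged_division_1[OF ab p, of g] by simp
  then show "h b - h a \<le> \<phi> b - \<phi> a + e"
    by (simp add: g_def)
qed

section \<open>Growth from a bound on the logarithmic derivative\<close>

lemma abs_ln_diff_le:
  fixes x y m :: real
  assumes "0 < m" "m \<le> x" "m \<le> y"
  shows "\<bar>ln x - ln y\<bar> \<le> \<bar>x - y\<bar> / m"
proof -
  have *: "ln u - ln v \<le> (u - v) / m" if "m \<le> v" "v \<le> u" for u v
  proof -
    have "ln u - ln v \<le> (u - v) / v"
      using ln_diff_le[of u v] assms(1) that by simp
    also have "\<dots> \<le> (u - v) / m"
      using assms(1) that by (intro divide_left_mono) auto
    finally show ?thesis .
  qed
  show ?thesis
  proof (cases "x \<le> y")
    case True
    then have "ln x \<le> ln y" using assms by simp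
    with True *[of x y] assms show ?thesis by simp
  next
    case False
    then have "ln y \<le> ln x" using assms by simp
    with False *[of y x] assms show ?thesis by simp
  qed
qed

text \<open>The logarithm is Lipschitz with constant 1 / m on [m, \<infinity>), so the modulus of f
  for \<epsilon> m serves for \<epsilon>.\<close>

lemma absolutely_continuous_on_ln:
  assumes ac: "absolutely_continuous_on {a..b} f" and "m > 0" and m: "\<And>t. t \<in> {a..b} \<Longrightarrow> m \<le> f t"
  shows "absolutely_continuous_on {a..b} (\<lambda>t. ln (f t))"
  unfolding absolutely_continuous_on_def
proof (intro allI impI)
  fix \<epsilon> :: real assume "\<epsilon> > 0"
  then obtain \<delta> where "\<delta> > 0" and \<delta>: "\<And>d. d division_of \<Union>d \<Longrightarrow> \<Union>d \<subseteq> {a..b} \<Longrightarrow>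
      (\<Sum>k\<in>d. Sup k - Inf k) < \<delta> \<Longrightarrow> (\<Sum>k\<in>d. \<bar>f (Sup k) - f (Inf k)\<bar>) < \<epsilon> * m"
    using ac[unfolded absolutely_continuous_on_def, rule_format, of "\<epsilon> * m"] \<open>m > 0\<close> by auto
  show "\<exists>\<delta>>0. \<forall>d. d division_of \<Union>d \<and> \<Union>d \<subseteq> {a..b} \<and> (\<Sum>k\<in>d. Sup k - Inf k) < \<delta>
      \<longrightarrow> (\<Sum>k\<in>d. \<bar>ln (f (Sup k)) - ln (f (Inf k))\<bar>) < \<epsilon>"
  proof (intro exI[of _ \<delta>] conjI \<open>\<delta> > 0\<close> allI impI, elim conjE)
    fix d :: "real set set"
    assume d: "d division_of \<Union>d" "\<Union>d \<subseteq> {a..b}" "(\<Sum>k\<in>d. Sup k - Inf k) < \<delta>"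
    have "(\<Sum>k\<in>d. \<bar>ln (f (Sup k)) - ln (f (Inf k))\<bar>)
        \<le> (\<Sum>k\<in>d. \<bar>f (Sup k) - f (Inf k)\<bar> / m)"
    proof (rule sum_mono)
      fix k assume k: "k \<in> d"
      obtain u v where "k = {u..v}" using division_ofD(4)[OF d(1) k] by (auto simp: box_real)
      moreover have "k \<noteq> {}" using division_ofD(3)[OF d(1) k] .
      moreover have "k \<subseteq> {a..b}" using k d(2) by blast
      ultimately have "Sup k \<in> {a..b}" "Inf k \<in> {a..b}" by auto
      then show "\<bar>ln (f (Sup k)) - ln (f (Inf k))\<bar> \<le> \<bar>f (Sup k) - f (Inf k)\<bar> / m"
        using abs_ln_diff_le[OF \<open>m > 0\<close>] m by blast
    qed
    also have "\<dots> < \<epsilon> * m / m"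
      using \<delta>[OF d] \<open>m > 0\<close> unfolding sum_divide_distrib[symmetric] by (intro divide_strict_right_mono)
    finally show "(\<Sum>k\<in>d. \<bar>ln (f (Sup k)) - ln (f (Inf k))\<bar>) < \<epsilon>"
      using \<open>m > 0\<close> by simp
  qed
qed

text \<open>The hypothesis says that ln f - \<alpha> ln has nonpositive derivative almost
  everywhere. \<open>absolutely_continuous_increment_le\<close> integrates this; monotonicity of f
  supplies the lower bound f s that makes ln f absolutely continuous.\<close>

lemma bounded_regularly_varying_growth:
  assumes f: "bounded_regularly_varying \<alpha> f" and "\<alpha> > 0"
  obtains t\<^sub>0 where "t\<^sub>0 > 0"
    and "\<And>s t. \<lbrakk>t\<^sub>0 \<le> s; s \<le> t\<rbrakk> \<Longrightarrow> f t \<le> (t / s) powr \<alpha> * f s"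
proof -
  from f obtain t\<^sub>0 where t\<^sub>0: "t\<^sub>0 > 0" and mono: "mono_on {t\<^sub>0..} f"
    and ac: "\<And>a b. t\<^sub>0 \<le> a \<Longrightarrow> a \<le> b \<Longrightarrow> absolutely_continuous_on {a..b} f"
    and ae: "AE t in lebesgue. t \<ge> t\<^sub>0 \<longrightarrow> f differentiable (at t) \<and> t * deriv f t / f t \<le> \<alpha>"
    and pos: "\<And>t. t > 0 \<Longrightarrow> f t > 0"
    unfolding bounded_regularly_varying_def by auto
  show thesis
  proof
    fix s t assume s: "t\<^sub>0 \<le> s" and st: "s \<le> t"
    have "s > 0" using t\<^sub>0 s by simp
    have fs: "f s \<le> f u" if "u \<in> {s..t}" for u
      using mono s that by (auto simp: mono_on_def)
    have "ln (f t) - ln (f s) \<le> \<alpha> * ln t - \<alpha> * ln s"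
    proof (rule absolutely_continuous_increment_le[OF st])
      show "absolutely_continuous_on {s..t} (\<lambda>u. ln (f u))"
        by (rule absolutely_continuous_on_ln[OF ac[OF s st] pos[OF \<open>s > 0\<close>] fs])
      show "mono_on {s..t} (\<lambda>u. \<alpha> * ln u)"
        using \<open>s > 0\<close> \<open>\<alpha> > 0\<close> by (auto simp: mono_on_def)
      show "AE u in lebesgue. u \<in> {s..t} \<longrightarrow>
        (\<exists>l\<le>0. ((\<lambda>u. ln (f u) - \<alpha> * ln u) has_real_derivative l) (at u within {s..t}))"
        using ae
      proof eventually_elim
        case (elim u)
        show ?case
        proof
          assume u: "u \<in> {s..t}"
          then have u0: "u > 0" "f u > 0" using \<open>s > 0\<close> pos by auto
          have "(f has_real_derivative deriv f u) (at u)"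
            using elim u s by (simp add: DERIV_deriv_iff_real_differentiable)
          then have "((\<lambda>u. ln (f u) - \<alpha> * ln u) has_real_derivative (deriv f u / f u - \<alpha> / u)) (at u)"
            using u0 by (auto intro!: derivative_eq_intros simp: field_simps)
          moreover have "deriv f u / f u - \<alpha> / u \<le> 0"
            using elim u s u0 by (simp add: field_simps)
          ultimately show "\<exists>l\<le>0. ((\<lambda>u. ln (f u) - \<alpha> * ln u) has_real_derivative l) (at u within {s..t})"
            using has_field_derivative_at_within by blast
        qed
      qed
    qed
    then have "ln (f t) \<le> \<alpha> * ln (t / s) + ln (f s)"
      using \<open>s > 0\<close> st by (simp add: ln_div right_diff_distrib)
    also have "\<dots> = ln ((t / s) powr \<alpha> * f s)"
      using \<open>s > 0\<close> st pos[of s] by (simp add: ln_mult ln_powr)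
    finally show "f t \<le> (t / s) powr \<alpha> * f s"
      using \<open>s > 0\<close> st pos[of s] pos[of t] by (subst (asm) ln_le_cancel_iff) auto
  qed (fact t\<^sub>0)
qed

section \<open>Decay rates\<close>

text \<open>Together with \<open>power_le_fact_binomial\<close> this makes the binomial coefficients
  comparable to (n + 1)^p, so they can serve as polynomial weights.\<close>

lemma binomial_le_power: "real ((j + p) choose p) \<le> (real j + 1) ^ p"
proof (induction p)
  case (Suc p)
  have "real (Suc p) * real ((j + Suc p) choose Suc p) = real (Suc (j + p)) * real ((j + p) choose p)"
    using Suc_times_binomial[of p "j + p"] by (metis add_Suc_right of_nat_mult)
  also have "\<dots> \<le> (real (Suc p) * (real j + 1)) * (real j + 1) ^ p"
    using Suc by (intro mult_mono) (auto simp: algebra_simps)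
  also have "\<dots> = real (Suc p) * (real j + 1) ^ Suc p"
    by simp
  finally show ?case
    by (simp only: mult_le_cancel_left_pos of_nat_0_less_iff zero_less_Suc)
qed simp

lemma power_le_fact_binomial: "(real n + 1) ^ p \<le> fact p * real ((n + p) choose p)"
proof (induction p)
  case (Suc p)
  have "(real n + 1) ^ Suc p \<le> (real n + 1) * (fact p * real ((n + p) choose p))"
    using Suc by (simp add: mult_left_mono)
  also have "\<dots> \<le> fact p * (real (Suc (n + p)) * real ((n + p) choose p))"
    by (simp add: algebra_simps)
  also have "real (Suc (n + p)) * real ((n + p) choose p) = real (Suc p) * real ((n + Suc p) choose Suc p)"
    using Suc_times_binomial[of p "n + p"] by (metis add_Suc_right of_nat_mult)
  finally show ?case
    by (simp add: mult_ac)
qed simp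

context small_resolvent_perturbation
begin

text \<open>For p = 0 the weight on T^j is 1 and the weight on A^n is n + 1, which cancels the
  factor lost in \<open>norm_funpow_perturbed_le\<close>.\<close>

lemma power_bounded_perturbed: "norm ((A ^^ n) x) \<le> K\<^sup>2 / (1 - q)\<^sup>2 * norm x"
proof -
  have "(real n + 1) * norm ((A ^^ n) x) \<le> K / (1 - q) ^ (0 + 2) * (real n + 1) * (K * norm x)"
    using norm_funpow_perturbed_le[of n 0 x "K * norm x"] K by (simp add: add.commute)
  also have "\<dots> = (real n + 1) * (K\<^sup>2 / (1 - q)\<^sup>2 * norm x)"
    by (simp add: power2_eq_square)
  finally show ?thesis
    by (rule mult_left_le_imp_le) simp
qed

text \<open>All weighted terms with j \<le> n are at most C n^p / f(n) times the norm of y. The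
  estimate for A^n then loses a factor n + 1, and dividing by the weight of order n^(p+1) leaves 1 /
  f(n).\<close>

lemma decay_perturbed:
  fixes S :: "'b::real_normed_vector \<Rightarrow> 'a"
  assumes S: "bounded_linear S"
    and \<alpha>: "\<alpha> > 0" and f: "bounded_regularly_varying \<alpha> f"
    and decay: "(\<lambda>n. onorm (T ^^ n \<circ> S)) \<in> O(\<lambda>n. 1 / f (real n))"
  shows "(\<lambda>n. onorm (A ^^ n \<circ> S)) \<in> O(\<lambda>n. 1 / f (real n))"
proof -
  have f_pos: "f t > 0" if "t > 0" for t
    using f that by (simp add: bounded_regularly_varying_def)
  obtain t\<^sub>0 where "t\<^sub>0 > 0" and growth: "\<And>s t. \<lbrakk>t\<^sub>0 \<le> s; s \<le> t\<rbrakk> \<Longrightarrow> f t \<le> (t / s) powr \<alpha> * f s"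
    using bounded_regularly_varying_growth[OF f \<alpha>] by blast
  define p where "p = nat \<lceil>\<alpha>\<rceil>"
  have p: "\<alpha> \<le> real p" by (simp add: p_def real_nat_ceiling_ge)
  have growth': "s ^ p / f s \<le> t ^ p / f t" if st: "t\<^sub>0 \<le> s" "s \<le> t" for s t
  proof -
    have "s > 0" "t > 0" using st \<open>t\<^sub>0 > 0\<close> by auto
    have "f t \<le> (t / s) powr \<alpha> * f s" using growth st .
    also have "\<dots> \<le> (t / s) powr real p * f s"
      using \<open>s > 0\<close> st p f_pos[of s] by (intro mult_right_mono powr_mono) (auto simp: field_simps)
    also have "(t / s) powr real p = (t / s) ^ p"
      using \<open>s > 0\<close> \<open>t > 0\<close> by (simp add: powr_realpow)
    finally show ?thesis
      using \<open>s > 0\<close> f_pos[of s] f_pos[of t] \<open>t > 0\<close> by (simp add: power_divide field_simps)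
  qed
  have blTS: "bounded_linear (T ^^ n \<circ> S)" for n
    using T S funpow_bounded_linear[of T n] bounded_linear_compose
    by (auto simp: bounded_clinear_def o_def)
  obtain c where "c > 0" and "\<forall>\<^sub>F n in sequentially. norm (onorm (T ^^ n \<circ> S)) \<le> c * norm (1 / f (real n))"
    using decay by (rule landau_o.bigE)
  then obtain N\<^sub>1 where N\<^sub>1: "\<And>n. n \<ge> N\<^sub>1 \<Longrightarrow> norm (onorm (T ^^ n \<circ> S)) \<le> c * norm (1 / f (real n))"
    by (auto simp: eventually_sequentially)
  \<comment> \<open>Beyond N the decay estimate and the growth bound both apply, and
    \<open>N \<ge> 1\<close> gives positivity of f and j + 1 \<le> 2 j.\<close>
  define N where "N = max N\<^sub>1 (max 1 (nat \<lceil>t\<^sub>0\<rceil>))"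
  have N: "N \<ge> 1" "t\<^sub>0 \<le> real N" "N \<ge> N\<^sub>1"
    by (auto simp: N_def le_max_iff_disj intro: order_trans[OF real_nat_ceiling_ge])
  have decay': "norm ((T ^^ j) (S y)) \<le> c / f (real j) * norm y" if "j \<ge> N" for j y
  proof -
    have "norm ((T ^^ j) (S y)) \<le> onorm (T ^^ j \<circ> S) * norm y"
      using onorm[OF blTS, of j y] by simp
    also have "onorm (T ^^ j \<circ> S) \<le> c / f (real j)"
      using N\<^sub>1[of j] that N f_pos[of "real j"] by simp
    finally show ?thesis by (simp add: mult_right_mono)
  qed
  \<comment> \<open>The first term serves j \<ge> N, with 2^p from j + 1 \<le> 2 j. The second
    serves j < N, where only power-boundedness is used and f(N) compensates for N^p / f(N).\<close>
  define C where "C = c * 2 ^ p + K * onorm S * f (real N)"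
  have bound: "real ((j + p) choose p) * norm ((T ^^ j) (S y)) \<le> C * (real n ^ p / f (real n)) * norm y"
    if "j \<le> n" "N \<le> n" for j n y
  proof (cases "N \<le> j")
    case True
    have j: "real j > 0" "f (real j) > 0" using True N f_pos[of "real j"] by auto
    have "real ((j + p) choose p) \<le> (real j + 1) ^ p"
      by (rule binomial_le_power)
    also have "\<dots> \<le> (2 * real j) ^ p"
      using j(1) by (intro power_mono) auto
    finally have "real ((j + p) choose p) * norm ((T ^^ j) (S y)) \<le> (2 * real j) ^ p * (c / f (real j) * norm y)"
      using decay'[OF True] by (intro mult_mono) auto
    also have "\<dots> = c * 2 ^ p * (real j ^ p / f (real j)) * norm y"
      by (simp add: power_mult_distrib)
    also have "\<dots> \<le> C * (real n ^ p / f (real n)) * norm y"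
      using \<open>c > 0\<close> True N that K_nonneg onorm_pos_le[OF S] f_pos[of "real N"] j
      by (intro mult_mono growth' mult_right_mono) (auto simp: C_def)
    finally show ?thesis .
  next
    case False
    have "real ((j + p) choose p) \<le> (real j + 1) ^ p"
      by (rule binomial_le_power)
    also have "\<dots> \<le> real N ^ p"
      using False by (intro power_mono) auto
    finally have "real ((j + p) choose p) \<le> real N ^ p" .
    moreover have "norm ((T ^^ j) (S y)) \<le> K * (onorm S * norm y)"
      using K[of j "S y"] onorm[OF S, of y] K_nonneg by (meson mult_left_mono order_trans)
    ultimately have "real ((j + p) choose p) * norm ((T ^^ j) (S y)) \<le> real N ^ p * (K * (onorm S * norm y))"
      by (intro mult_mono) auto
    also have "\<dots> = K * onorm S * f (real N) * (real N ^ p / f (real N)) * norm y"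
      using f_pos[of "real N"] N by simp
    also have "\<dots> \<le> C * (real n ^ p / f (real n)) * norm y"
      using \<open>c > 0\<close> N that K_nonneg onorm_pos_le[OF S] f_pos[of "real N"]
      by (intro mult_mono growth' mult_right_mono) (auto simp: C_def)
    finally show ?thesis .
  qed
  \<comment> \<open>The factorial comes from replacing the binomial weight by (n + 1)^(p+1).\<close>
  define M where "M = K / (1 - q) ^ (p + 2) * fact (Suc p) * C"
  have "C \<ge> 0"
    using \<open>c > 0\<close> K_nonneg onorm_pos_le[OF S] f_pos[of "real N"] N by (simp add: C_def)
  then have "M \<ge> 0" using K_nonneg q_less by (simp add: M_def)
  have "norm (onorm (A ^^ n \<circ> S)) \<le> M * norm (1 / f (real n))" if n: "n \<ge> N" for n
  proof -
    have fn: "f (real n) > 0" using N n by (intro f_pos) simp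
    have "onorm (A ^^ n \<circ> S) \<le> M / f (real n)"
    proof (rule onorm_bound)
      fix y
      have "(real n + 1) ^ Suc p * norm ((A ^^ n) (S y))
          \<le> fact (Suc p) * (real ((n + Suc p) choose Suc p) * norm ((A ^^ n) (S y)))"
        unfolding mult.assoc[symmetric] by (intro mult_right_mono power_le_fact_binomial) simp
      also have "\<dots> \<le> fact (Suc p) * (K / (1 - q) ^ (p + 2) * (real n + 1)
          * (C * (real n ^ p / f (real n)) * norm y))"
        using bound n by (intro mult_left_mono norm_funpow_perturbed_le) auto
      also have "\<dots> = M * (real n + 1) * (real n ^ p * (norm y / f (real n)))"
        unfolding M_def by (simp only: times_divide_eq_left times_divide_eq_right mult_ac)
      also have "\<dots> \<le> M * (real n + 1) * ((real n + 1) ^ p * (norm y / f (real n)))"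
        using \<open>M \<ge> 0\<close> fn by (intro mult_left_mono mult_right_mono power_mono) auto
      also have "\<dots> = (real n + 1) ^ Suc p * (M / f (real n) * norm y)"
        by simp
      finally have "norm ((A ^^ n) (S y)) \<le> M / f (real n) * norm y"
        by (rule mult_left_le_imp_le) simp
      then show "norm ((A ^^ n \<circ> S) y) \<le> M / f (real n) * norm y" by simp
    qed (use \<open>M \<ge> 0\<close> fn in simp)
    moreover have "0 \<le> onorm (A ^^ n \<circ> S)"
    proof (rule onorm_pos_le)
      have "bounded_linear A"
        using T D by (auto simp: bounded_clinear_def intro: bounded_linear_add)
      then show "bounded_linear (A ^^ n \<circ> S)"
        using bounded_linear_compose[OF funpow_bounded_linear S] by (simp add: o_def)
    qed
    ultimately show ?thesis using fn by simp
  qed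
  then show ?thesis
    by (intro bigoI[of _ M]) (auto simp: eventually_sequentially)
qed

end

section \<open>Reduction of the theorem to the locale\<close>

theorem corollary5p2:
  fixes T D :: "'x::chilbert_space \<Rightarrow> 'x"
    and S :: "'y::cbanach \<Rightarrow> 'x"
  assumes "bounded_clinear T" and "power_bounded T"
    and "bounded_clinear S"
    and "bounded_clinear D" and "D \<circ> T = T \<circ> D"
    and "(SUP \<mu>\<in>{\<mu>. cmod \<mu> > 1}. ereal (onorm (resolvent \<mu> T \<circ> D))) < 1"
  shows "power_bounded (\<lambda>x. T x + D x) \<and>
    (\<forall>\<alpha> f. \<alpha> > 0 \<and> bounded_regularly_varying \<alpha> f \<and>
        (\<lambda>n. onorm (T ^^ n \<circ> S)) \<in> O(\<lambda>n. 1 / f (real n)) \<longrightarrow>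
        (\<lambda>n. onorm ((\<lambda>x. T x + D x) ^^ n \<circ> S)) \<in> O(\<lambda>n. 1 / f (real n)))"
proof -
  obtain K where "K \<ge> 0" and K: "\<And>n x. norm ((T ^^ n) x) \<le> K * norm x"
    using \<open>power_bounded T\<close> unfolding power_bounded_iff by blast
  have R: "bounded_linear (resolvent \<mu> T)"
    "\<mu> *\<^sub>C resolvent \<mu> T x - T (resolvent \<mu> T x) = x" if "cmod \<mu> > 1" for \<mu> x
    using resolvent_power_bounded[OF \<open>bounded_clinear T\<close> K that] by blast+
  have blRD: "bounded_linear (resolvent \<mu> T \<circ> D)" if "cmod \<mu> > 1" for \<mu>
    using bounded_linear_compose[OF R(1)[OF that], of D] \<open>bounded_clinear D\<close>
    by (simp add: bounded_clinear_def o_def)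
  \<comment> \<open>The strict bound on the supremum leaves room for a real q below 1 that bounds
    every resolvent term.\<close>
  obtain q where q: "(SUP \<mu>\<in>{\<mu>. cmod \<mu> > 1}. ereal (onorm (resolvent \<mu> T \<circ> D))) < ereal q"
    "ereal q < 1"
    using assms(6) ereal_dense2 by blast
  have onorm_q: "onorm (resolvent \<mu> T \<circ> D) \<le> q" if "cmod \<mu> > 1" for \<mu>
  proof -
    have "ereal (onorm (resolvent \<mu> T \<circ> D)) \<le> (SUP \<mu>\<in>{\<mu>. cmod \<mu> > 1}. ereal (onorm (resolvent \<mu> T \<circ> D)))"
      using that by (intro SUP_upper) simp
    with q(1) have "ereal (onorm (resolvent \<mu> T \<circ> D)) \<le> ereal q" by (meson le_less_trans less_imp_le)
    then show ?thesis by simp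
  qed
  interpret small_resolvent_perturbation T D K q
  proof
    show "D (T x) = T (D x)" for x
      using \<open>D \<circ> T = T \<circ> D\<close> by (metis o_apply)
    show "\<exists>y. \<mu> *\<^sub>C y - T y = D x \<and> norm y \<le> q * norm x" if "cmod \<mu> > 1" for \<mu> x
    proof (intro exI conjI)
      show "\<mu> *\<^sub>C resolvent \<mu> T (D x) - T (resolvent \<mu> T (D x)) = D x"
        by (rule R(2)[OF that])
      have "norm ((resolvent \<mu> T \<circ> D) x) \<le> onorm (resolvent \<mu> T \<circ> D) * norm x"
        by (rule onorm[OF blRD[OF that]])
      also have "\<dots> \<le> q * norm x"
        by (intro mult_right_mono onorm_q that) simp
      finally show "norm (resolvent \<mu> T (D x)) \<le> q * norm x" by simp
    qed
    \<comment> \<open>Any point outside the closed disc, here 2, shows that q is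
      nonnegative.\<close>
    have "0 \<le> onorm (resolvent 2 T \<circ> D)"
      by (intro onorm_pos_le blRD) simp
    then show "0 \<le> q"
      using onorm_q[of 2] by simp
    show "q < 1" using q(2) by simp
  qed (fact assms K \<open>K \<ge> 0\<close>)+
  have "bounded_clinear (\<lambda>x. T x + D x)"
    using assms(1,4) by (auto simp: bounded_clinear_def scaleC_add_right intro: bounded_linear_add)
  then have "power_bounded (\<lambda>x. T x + D x)"
    unfolding power_bounded_iff using power_bounded_perturbed by (auto intro!: exI[of _ "K\<^sup>2 / (1 - q)\<^sup>2"])
  then show ?thesis
    using decay_perturbed \<open>bounded_clinear S\<close> by (auto simp: bounded_clinear_def)
qed

end
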